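(* Let $p\ge2$ be an integer. Suppose that $\alpha>0$, $(\beta_1,\beta_2)\in P_\alpha$, $\mathbf{a},\mathbf{b}\in\mathbb{R}^{p-1}$ with $\mathbf{a}>0$ (element-wise) and $v_{\mathbf{a},\mathbf{b}}(t)=\sum_{j=1}^{p-1}(t^{a_j}-t^{b_j})\ge0$ on $[0,1]$ (in particular, $\mathbf{b}\prec^W\mathbf{a}$ is sufficient). Then $${}_pF_{p+1}\!\left(\begin{matrix}\alpha,\mathbf{a}\\\beta_1,\beta_2,\mathbf{b}\end{matrix}\,\Big|\,x\right)\ge0\quad\text{for all }x\in\mathbb{R}.$$
   Context: For $\alpha>0$, $P_\alpha$ denotes the convex hull of the points $(\alpha_m,\infty)$, $(\alpha_m,\alpha_M)$, $(\alpha_M,\alpha_m)$, $(\infty,\alpha_m)$ in the $(\beta_1,\beta_2)$-plane, where $\alpha_m=\min(2\alpha,\alpha+1/2)$, $\alpha_M=\max(2\alpha,\alpha+1/2)$; i.e. $P_\alpha=\{(\beta_1,\beta_2):\beta_1\ge\alpha_m,\ \beta_2\ge\alpha_m,\ \beta_1+\beta_2\ge\alpha_m+\alpha_M\}$. For vectors of length $q$, $\mathbf{b}\prec^W\mathbf{a}$ (weak supermajorization) means that, after arranging the components in ascending order, $0<a_1\le\cdots\le a_q$, $0<b_1\le\cdots\le b_q$, and $\sum_{i=1}^ka_i\le\sum_{i=1}^kb_i$ for $k=1,\dots,q$. *)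

theory Defs
  imports "HOL-Analysis.Analysis"
begin

definition hypergeo :: "real list \<Rightarrow> real list \<Rightarrow> real \<Rightarrow> real" where
  "hypergeo as bs x = eval_fps (fps_hypergeo as bs 1) x"

definition alpha_min :: "real \<Rightarrow> real" where
  "alpha_min \<alpha> = min (2 * \<alpha>) (\<alpha> + 1/2)"

definition alpha_max :: "real \<Rightarrow> real" where
  "alpha_max \<alpha> = max (2 * \<alpha>) (\<alpha> + 1/2)"

text \<open>The convex hull of the points \<open>(m, \<infinity>)\<close>, \<open>(m, M)\<close>, \<open>(M, m)\<close>, \<open>(\<infinity>, m)\<close>, where
  \<open>m = alpha_min \<alpha>\<close> and \<open>M = alpha_max \<alpha>\<close>, given by its three half-planes.\<close>

definition P_region :: "real \<Rightarrow> (real \<times> real) set" where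
  "P_region \<alpha> = {(\<beta>1, \<beta>2). \<beta>1 \<ge> alpha_min \<alpha> \<and> \<beta>2 \<ge> alpha_min \<alpha> \<and>
     \<beta>1 + \<beta>2 \<ge> alpha_min \<alpha> + alpha_max \<alpha>}"

text \<open>Vectors are lists. For \<open>t = 0\<close>, \<open>powr\<close> gives \<open>0\<close> whatever the exponent, so the requirement
  that \<open>v_fun a b\<close> be nonnegative on \<open>{0..1}\<close> is the requirement on \<open>{0<..1}\<close>; together with
  \<open>a > 0\<close> this already forces all entries of \<open>b\<close> to be positive (let \<open>t\<close> tend to \<open>0\<close>).\<close>

definition v_fun :: "real list \<Rightarrow> real list \<Rightarrow> real \<Rightarrow> real" where
  "v_fun a b t = (\<Sum>j<length a. t powr (a ! j) - t powr (b ! j))"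

definition weak_supermajorized :: "real list \<Rightarrow> real list \<Rightarrow> bool" (infix "\<prec>\<^sup>W" 50) where
  "b \<prec>\<^sup>W a \<longleftrightarrow> length a = length b \<and> (\<forall>x\<in>set a. 0 < x) \<and> (\<forall>x\<in>set b. 0 < x) \<and>
     (\<forall>k\<in>{1..length a}. (\<Sum>i<k. sort a ! i) \<le> (\<Sum>i<k. sort b ! i))"

end

theory Submission
  imports Defs "HOL-Real_Asymp.Real_Asymp"
begin

text \<open>For the exponents \<open>(\<beta>1, \<beta>2) = (2 * \<alpha>, \<alpha> + 1/2)\<close> the function \<open>1F2\<close> is the square of a
  \<open>0F1\<close> (a power of the variable times the square of a Bessel function), so it is nonnegative on
  the real line. Every other function in the theorem arises from this square by multiplying the
  \<open>n\<close>-th Taylor coefficient by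
  \[ m(n) = \prod_j \frac{(A_j)_n}{(B_j)_n}, \quad A = (2 \alpha, \alpha + 1/2, \mathbf{a}),
     \quad B = (\beta_1, \beta_2, \mathbf{b}). \]
  What has to be shown is that such a multiplier preserves nonnegativity on the real line whenever
  \<open>(\<Sum>j. t powr A j - t powr B j) \<ge> 0\<close> for \<open>0 < t \<le> 1\<close>. This condition holds here because the region
  \<open>P_region \<alpha>\<close> consists of pairs that are weakly supermajorized by \<open>(2 * \<alpha>, \<alpha> + 1/2)\<close>, so the
  first two exponents contribute a nonnegative summand of their own, and the others contribute
  \<open>v_fun a b\<close>.

  One expects \<open>m\<close> to be the moment sequence of a measure on \<open>[0, 1]\<close>, namely a product of Gamma
  quotients whose logarithm has a Levy-Khintchine representation with a density proportional to
  \<open>\<Sum>j. t powr A j - t powr B j\<close>. No measure is needed, however. The multipliers that preserve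
  nonnegativity contain \<open>n \<mapsto> t ^ n\<close> for \<open>0 \<le> t \<le> 1\<close> (a rescaling of the variable) and are closed
  under nonnegative linear combinations, products, pointwise limits, integrals over a parameter
  and exponentials. Starting from \<open>t ^ n\<close>, an integral over \<open>t\<close> gives
  \<open>\<Sum>j. 1 / (A j + s + n) - 1 / (B j + s + n)\<close>, an integral over \<open>s\<close> followed by the exponential
  gives \<open>\<Prod>j. (B j + s + n) / (A j + s + n)\<close>, and an infinite product over \<open>s = 0, 1, 2, \<dots>\<close> gives
  the quotient of Pochhammer symbols
  (\<open>positivity_multiplier_sum_inverse\<close>, \<open>positivity_multiplier_prod_quotient\<close>,
  \<open>positivity_multiplier_pochhammer_quotient\<close>).\<close>

section \<open>Multipliers that preserve nonnegativity of entire functions\<close>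

definition nonneg_entire :: "(nat \<Rightarrow> real) \<Rightarrow> bool" where
  "nonneg_entire c \<longleftrightarrow> (\<forall>x. summable (\<lambda>n. \<bar>c n * x ^ n\<bar>) \<and> 0 \<le> (\<Sum>n. c n * x ^ n))"

text \<open>The bound \<open>\<bar>m n\<bar> \<le> m 0\<close>, which moment sequences of positive measures on \<open>[0, 1]\<close> satisfy, is
  part of the definition because it makes a pointwise limit of multipliers automatically a
  dominated one: the values at \<open>0\<close> converge, so they bound all the other values uniformly.\<close>

definition positivity_multiplier :: "(nat \<Rightarrow> real) \<Rightarrow> bool" where
  "positivity_multiplier m \<longleftrightarrow>
     (\<forall>n. \<bar>m n\<bar> \<le> m 0) \<and> (\<forall>c. nonneg_entire c \<longrightarrow> nonneg_entire (\<lambda>n. c n * m n))"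

lemma positivity_multiplierI:
  assumes "\<And>n. \<bar>m n\<bar> \<le> m 0"
    and "\<And>c x. nonneg_entire c \<Longrightarrow> 0 \<le> (\<Sum>n. c n * m n * x ^ n)"
  shows "positivity_multiplier m"
proof -
  have "summable (\<lambda>n. \<bar>c n * m n * x ^ n\<bar>)" if c: "nonneg_entire c" for c x
  proof (rule summable_comparison_test')
    show "summable (\<lambda>n. m 0 * \<bar>c n * x ^ n\<bar>)"
      using c by (intro summable_mult) (simp add: nonneg_entire_def)
    show "norm \<bar>c n * m n * x ^ n\<bar> \<le> m 0 * \<bar>c n * x ^ n\<bar>" for n
      using mult_right_mono[OF assms(1)[of n] abs_ge_zero[of "c n * x ^ n"]]
      by (simp add: abs_mult ac_simps)
  qed
  thus ?thesis
    using assms by (auto simp: positivity_multiplier_def nonneg_entire_def)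
qed

lemma positivity_multiplier_bound: "positivity_multiplier m \<Longrightarrow> \<bar>m n\<bar> \<le> m 0"
  by (simp add: positivity_multiplier_def)

lemma positivity_multiplier_0_nonneg: "positivity_multiplier m \<Longrightarrow> 0 \<le> m 0"
  using positivity_multiplier_bound[of m 0] by simp

lemma positivity_multiplier_summable:
  assumes "positivity_multiplier m" "nonneg_entire c"
  shows "summable (\<lambda>n. c n * m n * x ^ n)"
proof (rule summable_rabs_cancel)
  show "summable (\<lambda>n. \<bar>c n * m n * x ^ n\<bar>)"
    using assms by (auto simp: positivity_multiplier_def nonneg_entire_def)
qed

lemma positivity_multiplier_suminf_nonneg:
  assumes "positivity_multiplier m" "nonneg_entire c"
  shows "0 \<le> (\<Sum>n. c n * m n * x ^ n)"
  using assms by (auto simp: positivity_multiplier_def nonneg_entire_def)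

text \<open>Tannery's theorem, with the bound that the values at \<open>0\<close> provide.\<close>

lemma positivity_multiplier_tendsto:
  assumes m: "\<And>i::nat. positivity_multiplier (m i)"
    and lim: "\<And>n. (\<lambda>i. m i n) \<longlonglongrightarrow> l n"
  shows "positivity_multiplier l"
proof (rule positivity_multiplierI)
  show "\<bar>l n\<bar> \<le> l 0" for n
    using tendsto_rabs[OF lim[of n]] lim[of 0]
    by (rule LIMSEQ_le) (use positivity_multiplier_bound[OF m] in auto)
next
  fix c :: "nat \<Rightarrow> real" and x :: real
  assume c: "nonneg_entire c"
  obtain B where B: "\<And>i. \<bar>m i 0\<bar> \<le> B"
    using convergent_imp_Bseq[OF convergentI[OF lim[of 0]]] by (auto simp: Bseq_def)
  have bound: "\<bar>c n * m i n * x ^ n\<bar> \<le> B * \<bar>c n * x ^ n\<bar>" for i n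
  proof -
    have "\<bar>m i n\<bar> \<le> B"
      using positivity_multiplier_bound[OF m, of i n] B[of i] by linarith
    from mult_right_mono[OF this abs_ge_zero[of "c n * x ^ n"]] show ?thesis
      by (simp add: abs_mult ac_simps)
  qed
  have "(\<lambda>i. \<Sum>n. c n * m i n * x ^ n) \<longlonglongrightarrow> (\<Sum>n. c n * l n * x ^ n)"
  proof (rule tannerys_theorem[THEN conjunct2, THEN conjunct2])
    show "(\<lambda>i. c n * m i n * x ^ n) \<longlonglongrightarrow> c n * l n * x ^ n" for n
      by (intro tendsto_intros lim)
    show "summable (\<lambda>n. B * \<bar>c n * x ^ n\<bar>)"
      using c by (intro summable_mult) (simp add: nonneg_entire_def)
    show "\<forall>\<^sub>F (n, i) in at_top \<times>\<^sub>F sequentially. norm (c n * m i n * x ^ n) \<le> B * \<bar>c n * x ^ n\<bar>"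
      using bound by (intro always_eventually) auto
  qed auto
  thus "0 \<le> (\<Sum>n. c n * l n * x ^ n)"
    by (rule LIMSEQ_le_const) (use positivity_multiplier_suminf_nonneg[OF m c] in auto)
qed

lemma positivity_multiplier_const:
  assumes "0 \<le> k"
  shows "positivity_multiplier (\<lambda>_. k)"
proof (rule positivity_multiplierI)
  fix c :: "nat \<Rightarrow> real" and x :: real
  assume "nonneg_entire c"
  hence "summable (\<lambda>n. c n * x ^ n)" and ge: "0 \<le> (\<Sum>n. c n * x ^ n)"
    by (auto simp: nonneg_entire_def intro: summable_rabs_cancel)
  hence "(\<Sum>n. c n * k * x ^ n) = k * (\<Sum>n. c n * x ^ n)"
    by (subst suminf_mult [symmetric]) (simp_all add: ac_simps)
  thus "0 \<le> (\<Sum>n. c n * k * x ^ n)" using assms ge by simp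
qed (use assms in auto)

lemma positivity_multiplier_mult:
  assumes m: "positivity_multiplier m" and m': "positivity_multiplier m'"
  shows "positivity_multiplier (\<lambda>n. m n * m' n)"
proof (rule positivity_multiplierI)
  show "\<bar>m n * m' n\<bar> \<le> m 0 * m' 0" for n
    unfolding abs_mult
    by (intro mult_mono positivity_multiplier_bound[OF m] positivity_multiplier_bound[OF m']
        positivity_multiplier_0_nonneg[OF m]) auto
  fix c :: "nat \<Rightarrow> real" and x :: real
  assume "nonneg_entire c"
  hence "nonneg_entire (\<lambda>n. c n * m n)"
    using m by (simp add: positivity_multiplier_def)
  from positivity_multiplier_suminf_nonneg[OF m' this, of x]
  show "0 \<le> (\<Sum>n. c n * (m n * m' n) * x ^ n)" by (simp add: ac_simps)
qed

lemma positivity_multiplier_add: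
  assumes m: "positivity_multiplier m" and m': "positivity_multiplier m'"
  shows "positivity_multiplier (\<lambda>n. m n + m' n)"
proof (rule positivity_multiplierI)
  show "\<bar>m n + m' n\<bar> \<le> m 0 + m' 0" for n
    using positivity_multiplier_bound[OF m, of n] positivity_multiplier_bound[OF m', of n]
    by linarith
  fix c :: "nat \<Rightarrow> real" and x :: real
  assume c: "nonneg_entire c"
  have "(\<Sum>n. c n * (m n + m' n) * x ^ n) = (\<Sum>n. c n * m n * x ^ n) + (\<Sum>n. c n * m' n * x ^ n)"
    using suminf_add[OF positivity_multiplier_summable[OF m c, of x]
        positivity_multiplier_summable[OF m' c, of x]]
    by (simp add: algebra_simps)
  thus "0 \<le> (\<Sum>n. c n * (m n + m' n) * x ^ n)"
    using positivity_multiplier_suminf_nonneg[OF m c, of x]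
      positivity_multiplier_suminf_nonneg[OF m' c, of x] by simp
qed

lemma positivity_multiplier_power:
  assumes "positivity_multiplier m"
  shows "positivity_multiplier (\<lambda>n. m n ^ k)"
  by (induction k) (simp_all add: positivity_multiplier_const positivity_multiplier_mult assms)

lemma positivity_multiplier_prod:
  assumes "\<And>k. k \<in> K \<Longrightarrow> positivity_multiplier (m k)"
  shows "positivity_multiplier (\<lambda>n. \<Prod>k\<in>K. m k n)"
  using assms
  by (induction K rule: infinite_finite_induct)
     (simp_all add: positivity_multiplier_const positivity_multiplier_mult)

lemma positivity_multiplier_sum:
  assumes "\<And>k. k \<in> K \<Longrightarrow> positivity_multiplier (m k)"
  shows "positivity_multiplier (\<lambda>n. \<Sum>k\<in>K. m k n)"
  using assms
  by (induction K rule: infinite_finite_induct)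
     (simp_all add: positivity_multiplier_const positivity_multiplier_add)

lemma positivity_multiplier_exp:
  assumes "positivity_multiplier m"
  shows "positivity_multiplier (\<lambda>n. exp (m n))"
proof (rule positivity_multiplier_tendsto)
  show "positivity_multiplier (\<lambda>n. \<Sum>k<i. m n ^ k * (1 / fact k))" for i
    by (intro positivity_multiplier_sum positivity_multiplier_mult positivity_multiplier_const
        positivity_multiplier_power assms) simp
  show "(\<lambda>i. \<Sum>k<i. m n ^ k * (1 / fact k)) \<longlonglongrightarrow> exp (m n)" for n
    using exp_converges[of "m n"] by (simp add: sums_def field_simps)
qed

lemma positivity_multiplier_geometric:
  assumes "0 \<le> t" "t \<le> 1"
  shows "positivity_multiplier (\<lambda>n. t ^ n)"
proof (rule positivity_multiplierI)
  show "\<bar>t ^ n\<bar> \<le> t ^ 0" for n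
    using assms by (simp add: power_le_one)
  fix c :: "nat \<Rightarrow> real" and x :: real
  assume "nonneg_entire c"
  hence "0 \<le> (\<Sum>n. c n * (t * x) ^ n)" by (simp add: nonneg_entire_def)
  thus "0 \<le> (\<Sum>n. c n * t ^ n * x ^ n)" by (simp add: power_mult_distrib ac_simps)
qed

text \<open>On the compact parameter interval the values \<open>m u 0\<close> are bounded, and they dominate all \<open>m u n\<close>.
  Hence the power series converges uniformly in the parameter, and the integral may be taken
  term by term; the result is an integral of nonnegative values.\<close>

lemma positivity_multiplier_integral:
  assumes m: "\<And>u. u \<in> {a..b} \<Longrightarrow> positivity_multiplier (m u)"
    and cont: "\<And>n. continuous_on {a..b::real} (\<lambda>u. m u n)"
  shows "positivity_multiplier (\<lambda>n. integral {a..b} (\<lambda>u. m u n))"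
proof (rule positivity_multiplierI)
  have int: "(\<lambda>u. m u n) integrable_on {a..b}" for n
    by (rule integrable_continuous_real[OF cont])
  show "\<bar>integral {a..b} (\<lambda>u. m u n)\<bar> \<le> integral {a..b} (\<lambda>u. m u 0)" for n
    using integral_norm_bound_integral[OF int int, of n 0]
      positivity_multiplier_bound[OF m] by simp
  fix c :: "nat \<Rightarrow> real" and x :: real
  assume c: "nonneg_entire c"
  define f where "f = (\<lambda>u. \<Sum>n. c n * m u n * x ^ n)"
  have "bounded ((\<lambda>u. m u 0) ` {a..b})"
    by (intro compact_imp_bounded compact_continuous_image cont) auto
  then obtain B where "\<forall>y\<in>(\<lambda>u. m u 0) ` {a..b}. norm y \<le> B"
    unfolding bounded_iff ..
  hence B: "\<bar>m u 0\<bar> \<le> B" if "u \<in> {a..b}" for u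
    using that by auto
  have bound: "norm (c n * m u n * x ^ n) \<le> B * \<bar>c n * x ^ n\<bar>" if "u \<in> {a..b}" for u n
  proof -
    have "\<bar>m u n\<bar> \<le> B"
      using positivity_multiplier_bound[OF m[OF that], of n] B[OF that] by linarith
    from mult_right_mono[OF this abs_ge_zero[of "c n * x ^ n"]] show ?thesis
      by (simp add: abs_mult ac_simps)
  qed
  have "uniform_limit {a..b} (\<lambda>N u. \<Sum>n<N. c n * m u n * x ^ n) f sequentially"
    unfolding f_def
  proof (rule Weierstrass_m_test[OF bound])
    show "summable (\<lambda>n. B * \<bar>c n * x ^ n\<bar>)"
      using c by (intro summable_mult) (simp add: nonneg_entire_def)
  qed
  moreover have "continuous_on {a..b} (\<lambda>u. \<Sum>n<N. c n * m u n * x ^ n)" for N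
    by (intro continuous_intros cont)
  ultimately obtain I J where
      I: "\<And>N. ((\<lambda>u. \<Sum>n<N. c n * m u n * x ^ n) has_integral I N) {a..b}"
    and J: "(f has_integral J) {a..b}" and IJ: "I \<longlonglongrightarrow> J"
    by (rule uniform_limit_integral) auto
  have "((\<lambda>u. \<Sum>n<N. c n * m u n * x ^ n) has_integral
      (\<Sum>n<N. c n * integral {a..b} (\<lambda>u. m u n) * x ^ n)) {a..b}" for N
    by (intro has_integral_sum has_integral_mult_left has_integral_mult_right
        integrable_integral int) auto
  hence "I = (\<lambda>N. \<Sum>n<N. c n * integral {a..b} (\<lambda>u. m u n) * x ^ n)"
    using has_integral_unique[OF I] by blast
  hence "(\<lambda>n. c n * integral {a..b} (\<lambda>u. m u n) * x ^ n) sums J"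
    using IJ by (simp add: sums_def)
  moreover have "0 \<le> J"
    using J by (rule has_integral_nonneg)
       (auto simp: f_def intro!: positivity_multiplier_suminf_nonneg m c)
  ultimately show "0 \<le> (\<Sum>n. c n * integral {a..b} (\<lambda>u. m u n) * x ^ n)"
    by (simp add: sums_iff)
qed

section \<open>Quotients of Pochhammer symbols as multipliers\<close>

lemma has_integral_powr_minus_1:
  fixes A e :: real
  assumes "0 < A" "0 < e" "e \<le> 1"
  shows "((\<lambda>t. t powr (A - 1)) has_integral (1 - e powr A) / A) {e..1}"
proof -
  have "((\<lambda>t. t powr (A - 1)) has_integral 1 powr A / A - e powr A / A) {e..1}"
  proof (rule fundamental_theorem_of_calculus)
    fix t assume "t \<in> {e..1}"
    hence "((\<lambda>t. t powr A / A) has_real_derivative t powr (A - 1)) (at t)"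
      using assms by (auto intro!: derivative_eq_intros)
    thus "((\<lambda>t. t powr A / A) has_vector_derivative t powr (A - 1)) (at t within {e..1})"
      by (simp add: has_real_derivative_iff_has_vector_derivative[symmetric] has_field_derivative_at_within)
  qed (use assms in auto)
  thus ?thesis by (simp add: diff_divide_distrib)
qed

lemma inverse_Suc_powr_tendsto_0:
  assumes "0 < y"
  shows "(\<lambda>i. inverse (real (Suc i)) powr y) \<longlonglongrightarrow> 0"
  using tendsto_powr'[OF LIMSEQ_inverse_real_of_nat tendsto_const[of y]] assms by simp

text \<open>The values are the moments \<open>\<integral> t ^ n * t powr (s - 1) * v t dt\<close> over \<open>(0, 1]\<close>, where \<open>v\<close> is the
  nonnegative function in the hypothesis. The integrand may be singular at \<open>0\<close>, so the integral is
  obtained as the limit of the integrals over \<open>[\<epsilon>, 1]\<close>.\<close>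

lemma positivity_multiplier_sum_inverse:
  fixes A B :: "'j \<Rightarrow> real"
  assumes J: "finite J" and pos: "\<And>j. j \<in> J \<Longrightarrow> 0 < A j" "\<And>j. j \<in> J \<Longrightarrow> 0 < B j"
    and v: "\<And>t. 0 < t \<Longrightarrow> t \<le> 1 \<Longrightarrow> 0 \<le> (\<Sum>j\<in>J. t powr A j - t powr B j)"
    and s: "0 \<le> s"
  shows "positivity_multiplier (\<lambda>n. \<Sum>j\<in>J. 1 / (A j + s + n) - 1 / (B j + s + n))"
proof -
  define v where "v t = (\<Sum>j\<in>J. t powr A j - t powr B j)" for t
  define m where "m e n = integral {e..1} (\<lambda>t. t ^ n * (t powr (s - 1) * v t))" for e and n :: nat
  define \<epsilon> where "\<epsilon> i = inverse (real (Suc i))" for i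
  have \<epsilon>: "0 < \<epsilon> i" "\<epsilon> i \<le> 1" for i
    by (auto simp: \<epsilon>_def divide_simps)
  have AB: "0 < A j + s + n" "0 < B j + s + n" if "j \<in> J" for j and n :: nat
    using pos[OF that] s by auto
  have pm: "positivity_multiplier (m e)" if "0 < e" for e
    unfolding m_def
  proof (rule positivity_multiplier_integral)
    show "positivity_multiplier (\<lambda>n. t ^ n * (t powr (s - 1) * v t))" if "t \<in> {e..1}" for t
      using that \<open>0 < e\<close> v[of t]
      by (intro positivity_multiplier_mult positivity_multiplier_geometric
          positivity_multiplier_const) (auto simp: v_def)
    show "continuous_on {e..1} (\<lambda>t. t ^ n * (t powr (s - 1) * v t))" for n
      unfolding v_def using \<open>0 < e\<close> by (intro continuous_intros) auto
  qed
  have m_eq: "m e n = (\<Sum>j\<in>J. (1 - e powr (A j + s + n)) / (A j + s + n)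
                          - (1 - e powr (B j + s + n)) / (B j + s + n))"
    if e: "0 < e" "e \<le> 1" for e n
  proof -
    have "((\<lambda>t. \<Sum>j\<in>J. t powr (A j + s + n - 1) - t powr (B j + s + n - 1)) has_integral
        (\<Sum>j\<in>J. (1 - e powr (A j + s + n)) / (A j + s + n)
              - (1 - e powr (B j + s + n)) / (B j + s + n))) {e..1}"
      using AB e J by (intro has_integral_sum has_integral_diff has_integral_powr_minus_1) auto
    moreover have "(\<Sum>j\<in>J. t powr (A j + s + n - 1) - t powr (B j + s + n - 1)) =
        t ^ n * (t powr (s - 1) * v t)" if "t \<in> {e..1}" for t
    proof -
      have "t powr (y + s + n - 1) = t ^ n * (t powr (s - 1) * t powr y)" for y
        using that e by (simp flip: powr_realpow powr_add add: algebra_simps)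
      thus ?thesis
        by (simp add: v_def sum_distrib_left right_diff_distrib)
    qed
    ultimately show ?thesis
      unfolding m_def by (intro integral_unique) (rule has_integral_eq)
  qed
  show ?thesis
  proof (rule positivity_multiplier_tendsto)
    show "positivity_multiplier (m (\<epsilon> i))" for i
      by (intro pm \<epsilon>)
    fix n :: nat
    have "(\<lambda>i. \<epsilon> i powr y) \<longlonglongrightarrow> 0" if "0 < y" for y
      unfolding \<epsilon>_def using that by (rule inverse_Suc_powr_tendsto_0)
    hence "(\<lambda>i. \<Sum>j\<in>J. (1 - \<epsilon> i powr (A j + s + n)) / (A j + s + n)
                          - (1 - \<epsilon> i powr (B j + s + n)) / (B j + s + n)) \<longlonglongrightarrow>
          (\<Sum>j\<in>J. (1 - 0) / (A j + s + n) - (1 - 0) / (B j + s + n))"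
      using AB[of _ n] by (intro tendsto_intros) (auto simp: less_imp_neq[symmetric])
    thus "(\<lambda>i. m (\<epsilon> i) n) \<longlonglongrightarrow> (\<Sum>j\<in>J. 1 / (A j + s + n) - 1 / (B j + s + n))"
      using \<epsilon> by (simp add: m_eq)
  qed
qed

text \<open>The logarithm of the product \<open>q\<close> at the shift \<open>s\<close> is the integral over all \<open>u \<ge> 0\<close> of the
  multipliers of the preceding lemma at the shifts \<open>s + u\<close>, because \<open>q\<close> tends to \<open>1\<close> at infinity.
  The integral over \<open>[0, U]\<close> has the exponential \<open>q 0 n / q U n\<close>, and then \<open>U\<close> tends to infinity.\<close>

lemma positivity_multiplier_prod_quotient:
  fixes A B :: "'j \<Rightarrow> real"
  assumes J: "finite J" and pos: "\<And>j. j \<in> J \<Longrightarrow> 0 < A j" "\<And>j. j \<in> J \<Longrightarrow> 0 < B j"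
    and v: "\<And>t. 0 < t \<Longrightarrow> t \<le> 1 \<Longrightarrow> 0 \<le> (\<Sum>j\<in>J. t powr A j - t powr B j)"
    and s: "0 \<le> s"
  shows "positivity_multiplier (\<lambda>n. \<Prod>j\<in>J. (B j + s + n) / (A j + s + n))"
proof -
  define d where "d u n = (\<Sum>j\<in>J. 1 / (A j + (s + u) + n) - 1 / (B j + (s + u) + n))"
    for u and n :: nat
  define q where "q u n = (\<Prod>j\<in>J. (B j + s + u + n) / (A j + s + u + n))" for u and n :: nat
  have AB: "0 < A j + s + u + n" "0 < B j + s + u + n"
    if "j \<in> J" "0 \<le> u" for j u and n :: nat
    using pos[OF that(1)] that(2) s by auto
  have exp_eq: "exp (integral {0..U} (\<lambda>u. d u n)) = q 0 n / q U n" if U: "0 \<le> U" for U n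
  proof -
    \<comment> \<open>\<open>D\<close> is a primitive of \<open>d\<close>, and \<open>exp (- D u)\<close> is the product \<open>q u n\<close>.\<close>
    define D where "D u = (\<Sum>j\<in>J. ln (A j + s + u + n) - ln (B j + s + u + n))" for u
    have "((\<lambda>u. d u n) has_integral D U - D 0) {0..U}"
    proof (rule fundamental_theorem_of_calculus[OF U])
      fix u assume u: "u \<in> {0..U}"
      have "(D has_real_derivative d u n) (at u)"
        unfolding D_def d_def using AB[of _ u n] u
        by (auto intro!: derivative_eq_intros sum.cong simp: divide_simps add_ac)
      thus "(D has_vector_derivative d u n) (at u within {0..U})"
        by (simp add: has_real_derivative_iff_has_vector_derivative[symmetric] has_field_derivative_at_within)
    qed
    moreover have "exp (- D u) = q u n" if "0 \<le> u" for u
      unfolding D_def q_def using AB[of _ u n] that J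
      by (auto simp: exp_sum exp_diff exp_minus sum_negf[symmetric] intro!: prod.cong)
    hence "exp (- D 0) / exp (- D U) = q 0 n / q U n"
      using U by simp
    hence "exp (D U - D 0) = q 0 n / q U n"
      by (simp flip: exp_diff)
    ultimately show ?thesis by (simp add: integral_unique)
  qed
  have "positivity_multiplier (\<lambda>n. exp (integral {0..U} (\<lambda>u. d u n)))" for U
  proof (intro positivity_multiplier_exp positivity_multiplier_integral)
    show "positivity_multiplier (d u)" if "u \<in> {0..U}" for u
      unfolding d_def using that s by (intro positivity_multiplier_sum_inverse J pos v) auto
    show "continuous_on {0..U} (\<lambda>u. d u n)" for n
    proof -
      have "A j + (s + u) + n \<noteq> 0" "B j + (s + u) + n \<noteq> 0" if "j \<in> J" "u \<in> {0..U}" for j u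
        using AB[of j u n] that by (auto simp: add.assoc)
      thus ?thesis unfolding d_def by (intro continuous_intros ballI)
    qed
  qed
  from this[of "real i" for i] have "positivity_multiplier (\<lambda>n. q 0 n / q (real i) n)" for i
    by (simp add: exp_eq)
  moreover have "(\<lambda>i. q 0 n / q (real i) n) \<longlonglongrightarrow> q 0 n / (\<Prod>j\<in>J. 1)" for n
  proof -
    have "(\<lambda>i. (B j + s + real i + n) / (A j + s + real i + n)) \<longlonglongrightarrow> 1" for j
      by real_asymp
    thus ?thesis unfolding q_def by (intro tendsto_intros) auto
  qed
  ultimately have "positivity_multiplier (\<lambda>n. q 0 n / (\<Prod>j\<in>J. 1))"
    by (rule positivity_multiplier_tendsto)
  thus ?thesis by (simp add: q_def)
qed

text \<open>This is Gauss's product for the Gamma function. The product over the shifts \<open>k < N\<close>, normalized to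
  be \<open>1\<close> at \<open>n = 0\<close>, is \<open>(A)\<^sub>N (B + n)\<^sub>N / ((B)\<^sub>N (A + n)\<^sub>N)\<close>. Splitting \<open>(A)\<^sub>N\<^sub>+\<^sub>n\<close> and \<open>(B)\<^sub>N\<^sub>+\<^sub>n\<close> after \<open>N\<close> or
  after \<open>n\<close> factors turns this into the desired quotient times \<open>(B + N)\<^sub>n / (A + N)\<^sub>n\<close>, which
  tends to \<open>1\<close> for fixed \<open>n\<close>.\<close>

lemma positivity_multiplier_pochhammer_quotient:
  fixes A B :: "'j \<Rightarrow> real"
  assumes J: "finite J" and pos: "\<And>j. j \<in> J \<Longrightarrow> 0 < A j" "\<And>j. j \<in> J \<Longrightarrow> 0 < B j"
    and v: "\<And>t. 0 < t \<Longrightarrow> t \<le> 1 \<Longrightarrow> 0 \<le> (\<Sum>j\<in>J. t powr A j - t powr B j)"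
  shows "positivity_multiplier (\<lambda>n. \<Prod>j\<in>J. pochhammer (A j) n / pochhammer (B j) n)"
proof (rule positivity_multiplier_tendsto)
  define m where "m N n = (\<Prod>k<N. (\<Prod>j\<in>J. (A j + k) / (B j + k)) *
      (\<Prod>j\<in>J. (B j + k + n) / (A j + k + n)))" for N n :: nat
  show "positivity_multiplier (m N)" for N
    unfolding m_def using pos
    by (intro positivity_multiplier_prod positivity_multiplier_mult positivity_multiplier_const
        positivity_multiplier_prod_quotient J v prod_nonneg)
       (auto intro!: divide_nonneg_nonneg add_nonneg_nonneg simp: less_imp_le)
  fix n
  have "m N n = (\<Prod>j\<in>J. pochhammer (A j) n / pochhammer (B j) n *
      (pochhammer (B j + N) n / pochhammer (A j + N) n))" for N
  proof -
    have "m N n = (\<Prod>j\<in>J. \<Prod>k<N. (A j + k) / (B j + k) * ((B j + k + n) / (A j + k + n)))"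
      unfolding m_def by (simp only: prod.distrib[symmetric]) (rule prod.swap)
    also have "\<dots> = (\<Prod>j\<in>J. pochhammer (A j) n / pochhammer (B j) n *
      (pochhammer (B j + N) n / pochhammer (A j + N) n))"
    proof (rule prod.cong[OF refl])
      fix j assume j: "j \<in> J"
      have "(\<Prod>k<N. (A j + k) / (B j + k) * ((B j + k + n) / (A j + k + n))) =
          pochhammer (A j) N / pochhammer (B j) N * (pochhammer (B j + n) N / pochhammer (A j + n) N)"
        by (simp add: prod.distrib prod_dividef pochhammer_prod atLeast0LessThan add_ac)
      also have "\<dots> = pochhammer (A j) n / pochhammer (B j) n *
          (pochhammer (B j + N) n / pochhammer (A j + N) n)"
      proof -
        have swap: "pochhammer y N / pochhammer (y + n) N = pochhammer y n / pochhammer (y + N) n"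
          if "0 < y" for y :: real
        proof -
          have "pochhammer y N * pochhammer (y + N) n = pochhammer y n * pochhammer (y + n) N"
            using pochhammer_product'[of y N n] pochhammer_product'[of y n N]
            by (simp add: add.commute)
          moreover have "pochhammer (y + n) N > 0" "pochhammer (y + N) n > 0"
            using that by (auto intro!: pochhammer_pos)
          ultimately show ?thesis by (simp add: field_simps)
        qed
        have "pochhammer (A j) N / pochhammer (B j) N * (pochhammer (B j + n) N / pochhammer (A j + n) N) =
            (pochhammer (A j) N / pochhammer (A j + n) N) / (pochhammer (B j) N / pochhammer (B j + n) N)"
          by simp
        also have "\<dots> = (pochhammer (A j) n / pochhammer (A j + N) n) /
            (pochhammer (B j) n / pochhammer (B j + N) n)"
          by (simp only: swap[OF pos(1)[OF j]] swap[OF pos(2)[OF j]])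
        finally show ?thesis by simp
      qed
      finally show "(\<Prod>k<N. (A j + k) / (B j + k) * ((B j + k + n) / (A j + k + n))) =
          pochhammer (A j) n / pochhammer (B j) n *
          (pochhammer (B j + N) n / pochhammer (A j + N) n)" .
    qed
    finally show ?thesis .
  qed
  moreover have "(\<lambda>N. pochhammer (B j + real N) n / pochhammer (A j + real N) n) \<longlonglongrightarrow> 1" for j
  proof -
    have "(\<lambda>N. (B j + real N + k) / (A j + real N + k)) \<longlonglongrightarrow> 1" for k :: nat
      by real_asymp
    hence "(\<lambda>N. \<Prod>k\<in>{0..<n}. (B j + real N + k) / (A j + real N + k)) \<longlonglongrightarrow> (\<Prod>k\<in>{0..<n}. 1)"
      by (intro tendsto_prod)
    thus ?thesis by (simp add: pochhammer_prod prod_dividef)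
  qed
  hence "(\<lambda>N. \<Prod>j\<in>J. pochhammer (A j) n / pochhammer (B j) n *
      (pochhammer (B j + real N) n / pochhammer (A j + real N) n)) \<longlonglongrightarrow>
      (\<Prod>j\<in>J. pochhammer (A j) n / pochhammer (B j) n * 1)"
    by (intro tendsto_intros)
  ultimately show "(\<lambda>N. m N n) \<longlonglongrightarrow> (\<Prod>j\<in>J. pochhammer (A j) n / pochhammer (B j) n)"
    by simp
qed


section \<open>Weak supermajorization and power sums\<close>

lemma v_fun_Cons: "v_fun (x # xs) (y # ys) t = t powr x - t powr y + v_fun xs ys t"
  by (simp add: v_fun_def sum.lessThan_Suc_shift del: sum.lessThan_Suc)

lemma v_fun_eq_sum_list:
  assumes "length a = length b"
  shows "v_fun a b t = (\<Sum>x\<leftarrow>a. t powr x) - (\<Sum>y\<leftarrow>b. t powr y)"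
  using assms by (simp add: v_fun_def sum_subtractf sum_list_sum_nth atLeast0LessThan)

lemma v_fun_sort:
  assumes "length a = length b"
  shows "v_fun (sort a) (sort b) t = v_fun a b t"
proof -
  have "(\<Sum>x\<leftarrow>sort xs. t powr x) = (\<Sum>x\<leftarrow>xs. t powr x)" for xs
    by (metis mset_map mset_sort sum_mset_sum_list)
  thus ?thesis using assms by (simp add: v_fun_eq_sum_list)
qed

text \<open>As \<open>t\<close> tends to \<open>0\<close> the powers with exponents in \<open>a\<close> vanish, while a single exponent \<open>\<le> 0\<close> in \<open>b\<close>
  would keep the sum of the other powers at least \<open>1\<close>.\<close>

lemma v_fun_nonneg_imp_pos:
  assumes len: "length a = length b" and a: "\<forall>x\<in>set a. 0 < x"
    and v: "\<forall>t\<in>{0..1}. 0 \<le> v_fun a b t"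
  shows "\<forall>y\<in>set b. 0 < y"
proof (rule ccontr)
  assume "\<not> (\<forall>y\<in>set b. 0 < y)"
  then obtain k where k: "k < length b" "b ! k \<le> 0"
    by (auto simp: in_set_conv_nth not_less)
  have "1 \<le> (\<Sum>j<length a. inverse (real (Suc i)) powr (a ! j))" for i
  proof -
    define t where "t = inverse (real (Suc i))"
    have t: "0 < t" "t \<le> 1" by (auto simp: t_def divide_simps)
    have "t powr 0 \<le> t powr (b ! k)"
      using t k(2) by (intro powr_mono') auto
    also have "\<dots> \<le> (\<Sum>j<length a. t powr (b ! j))"
      using k len by (intro member_le_sum) auto
    also have "\<dots> \<le> (\<Sum>j<length a. t powr (a ! j))"
      using v t by (simp add: v_fun_def sum_subtractf)
    finally show ?thesis using t by (simp add: t_def)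
  qed
  moreover have "(\<lambda>i. \<Sum>j<length a. inverse (real (Suc i)) powr (a ! j)) \<longlonglongrightarrow> (\<Sum>j<length a. 0)"
    by (intro tendsto_sum inverse_Suc_powr_tendsto_0) (use a in auto)
  ultimately have "1 \<le> (\<Sum>j<length a. 0::real)"
    by (intro LIMSEQ_le_const) auto
  thus False by simp
qed

text \<open>Summation by parts; the induction in the proof carries the stronger claim that the weighted sum
  is at least the last weight times the plain sum.\<close>

lemma sum_weighted_nonneg_Abel:
  fixes w d :: "nat \<Rightarrow> real"
  assumes w: "\<And>i. i < q \<Longrightarrow> 0 \<le> w i" "\<And>i. Suc i < q \<Longrightarrow> w (Suc i) \<le> w i"
    and d: "\<And>k. k \<in> {1..q} \<Longrightarrow> 0 \<le> (\<Sum>i<k. d i)"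
  shows "0 \<le> (\<Sum>i<q. w i * d i)"
proof (cases q)
  case (Suc r)
  have "w k * (\<Sum>i<Suc k. d i) \<le> (\<Sum>i<Suc k. w i * d i)" if "k < q" for k
    using that
  proof (induction k)
    case (Suc k)
    have "w (Suc k) * (\<Sum>i<Suc k. d i) \<le> w k * (\<Sum>i<Suc k. d i)"
      using Suc.prems by (intro mult_right_mono w d) auto
    also have "\<dots> \<le> (\<Sum>i<Suc k. w i * d i)"
      using Suc by auto
    finally show ?case by (simp add: distrib_left)
  qed auto
  from this[of r] show ?thesis
    using Suc w(1)[of r] d[of q] by (force intro: order_trans[OF mult_nonneg_nonneg])
qed auto

lemma powr_diff_ge_tangent:
  fixes t x y :: real
  assumes "0 < t"
  shows "t powr y * (- ln t) * (y - x) \<le> t powr x - t powr y"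
proof -
  have "t powr y * (1 + (- ln t) * (y - x)) \<le> t powr y * exp ((- ln t) * (y - x))"
    by (intro mult_left_mono exp_ge_add_one_self) auto
  also have "\<dots> = t powr x"
    using assms by (simp add: powr_def exp_add[symmetric] algebra_simps)
  finally show ?thesis by (simp add: algebra_simps)
qed

text \<open>The function \<open>y \<mapsto> t powr y\<close> is convex and decreasing. By convexity the difference of powers is at
  least a weighted sum of the differences of the sorted entries, with weights that are nonnegative
  and decreasing; Abel summation then uses the partial sums in the definition of \<open>\<prec>\<^sup>W\<close>.\<close>

lemma weak_supermajorized_imp_v_fun_nonneg:
  assumes "b \<prec>\<^sup>W a" "t \<in> {0..1}"
  shows "0 \<le> v_fun a b t"
proof (cases "t = 0")
  case False
  hence t: "0 < t" "t \<le> 1" using assms by auto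
  define xs ys where "xs = sort a" and "ys = sort b"
  have len: "length a = length b" "length ys = length a"
    using assms by (auto simp: weak_supermajorized_def ys_def)
  have "0 \<le> (\<Sum>i<length a. (t powr (ys ! i) * (- ln t)) * (ys ! i - xs ! i))"
  proof (rule sum_weighted_nonneg_Abel)
    show "0 \<le> t powr (ys ! i) * (- ln t)" for i
      using t by (intro mult_nonneg_nonneg) auto
    show "t powr (ys ! Suc i) * (- ln t) \<le> t powr (ys ! i) * (- ln t)" if "Suc i < length a" for i
      using t that len
      by (intro mult_right_mono powr_mono' sorted_nth_mono) (auto simp: ys_def)
    show "0 \<le> (\<Sum>i<k. ys ! i - xs ! i)" if "k \<in> {1..length a}" for k
      using assms that by (simp add: weak_supermajorized_def sum_subtractf xs_def ys_def)
  qed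
  also have "\<dots> \<le> (\<Sum>i<length a. t powr (xs ! i) - t powr (ys ! i))"
    by (intro sum_mono powr_diff_ge_tangent t)
  also have "\<dots> = v_fun a b t"
    using v_fun_sort[OF len(1)] by (simp add: v_fun_def xs_def ys_def)
  finally show ?thesis .
qed (simp add: v_fun_def)

lemma P_region_imp_weak_supermajorized:
  assumes "0 < \<alpha>" "(\<beta>1, \<beta>2) \<in> P_region \<alpha>"
  shows "[\<beta>1, \<beta>2] \<prec>\<^sup>W [2 * \<alpha>, \<alpha> + 1/2]"
proof -
  have "{1..2} = {1, 2::nat}" by auto
  thus ?thesis
    using assms
    by (auto simp: weak_supermajorized_def P_region_def alpha_min_def alpha_max_def
        numeral_2_eq_2 min_def max_def split: if_splits)
qed

section \<open>The square of a Bessel function and the positivity theorem\<close>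

lemma positivity_multiplier_pochhammer_lists:
  assumes len: "length as = length bs" and pos: "\<forall>x\<in>set as. 0 < x"
    and v: "\<forall>t\<in>{0..1}. 0 \<le> v_fun as bs t"
  shows "positivity_multiplier
    (\<lambda>n. \<Prod>j<length as. pochhammer (as ! j) n / pochhammer (bs ! j) n)"
  using assms v_fun_nonneg_imp_pos[OF assms]
  by (intro positivity_multiplier_pochhammer_quotient) (auto simp: v_fun_def)

text \<open>With \<open>c = \<alpha> + 1/2\<close>, reversing the factors of \<open>(c)\<^sub>n\<^sub>-\<^sub>k\<close> and \<open>(n - k)!\<close> makes the left-hand side a
  Chu-Vandermonde sum with the parameters \<open>1 - c - n\<close>, \<open>- n\<close> and \<open>c\<close>. Its value contains
  \<open>(2 * \<alpha> + n)\<^sub>n = (2 * \<alpha>)\<^sub>2\<^sub>n / (2 * \<alpha>)\<^sub>n\<close>, which the duplication formula expresses by \<open>(\<alpha>)\<^sub>n\<close> and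
  \<open>(c)\<^sub>n\<close>.\<close>

lemma sum_inverse_pochhammer_convolution:
  fixes \<alpha> :: real
  assumes "0 < \<alpha>"
  shows "(\<Sum>k\<le>n. 1 / (pochhammer (\<alpha> + 1/2) k * fact k) *
                  (1 / (pochhammer (\<alpha> + 1/2) (n - k) * fact (n - k)))) =
         4 ^ n * (pochhammer \<alpha> n / (pochhammer (2 * \<alpha>) n * pochhammer (\<alpha> + 1/2) n * fact n))"
proof -
  define c where "c = \<alpha> + 1/2"
  define S where "S = (\<Sum>k\<le>n. 1 / (pochhammer c k * fact k) *
                  (1 / (pochhammer c (n - k) * fact (n - k))))"
  have c: "0 < c" and pc: "pochhammer c k > 0" for k
    using assms by (auto simp: c_def intro!: pochhammer_pos)
  have term_eq: "pochhammer (1 - c - n) k * pochhammer (- real n) k / (fact k * pochhammer c k) =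
      pochhammer c n * fact n * (1 / (pochhammer c k * fact k) *
        (1 / (pochhammer c (n - k) * fact (n - k))))" if k: "k \<le> n" for k
  proof -
    \<comment> \<open>Used at \<open>y = c\<close> and at \<open>y = 1\<close>, where the symbols are factorials.\<close>
    have flip: "pochhammer y (n - k) * pochhammer (- (y + n - 1)) k = (-1) ^ k * pochhammer y n"
      for y :: real
    proof -
      have "pochhammer (- (y + n - 1)) k = (-1) ^ k * pochhammer (y + real (n - k)) k"
        using k by (subst pochhammer_minus) (simp add: of_nat_diff algebra_simps)
      thus ?thesis
        using pochhammer_product'[of y "n - k" k] k by simp
    qed
    have *: "pochhammer (1 - c - n) k = (-1) ^ k * pochhammer c n / pochhammer c (n - k)"
      using flip[of c] pc[of "n - k"] by (simp add: field_simps)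
    have **: "pochhammer (- real n) k = (-1) ^ k * fact n / fact (n - k)"
      using flip[of 1] by (simp add: pochhammer_fact[symmetric] field_simps)
    show ?thesis
      unfolding * ** by (simp add: field_simps flip: power_mult_distrib)
  qed
  have "pochhammer c n * fact n * S =
      (\<Sum>k=0..n. pochhammer (1 - c - n) k * pochhammer (- real n) k / (of_nat (fact k) * pochhammer c k))"
    unfolding S_def sum_distrib_left atLeast0AtMost
    by (intro sum.cong) (simp_all add: term_eq)
  also have "\<dots> = pochhammer (c - (1 - c - n)) n / pochhammer c n"
    using c by (intro Vandermonde_pochhammer) (auto simp: eq_neg_iff_add_eq_0)
  also have "c - (1 - c - n) = 2 * \<alpha> + n"
    by (simp add: c_def)
  finally have S: "pochhammer c n * fact n * S * pochhammer c n = pochhammer (2 * \<alpha> + n) n"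
    using pc[of n] by (simp add: field_simps)
  have "pochhammer (2 * \<alpha>) n * pochhammer (2 * \<alpha> + n) n = 4 ^ n * pochhammer \<alpha> n * pochhammer c n"
    using pochhammer_double[of \<alpha> n] pochhammer_product'[of "2 * \<alpha>" n n]
    by (simp add: c_def power_mult mult_2[symmetric])
  hence "(pochhammer (2 * \<alpha>) n * (pochhammer c n * fact n * S)) * pochhammer c n =
      (4 ^ n * pochhammer \<alpha> n) * pochhammer c n"
    by (simp only: S[symmetric] mult.assoc)
  hence "pochhammer (2 * \<alpha>) n * (pochhammer c n * fact n * S) = 4 ^ n * pochhammer \<alpha> n"
    using pc[of n] by simp
  hence "S = 4 ^ n * (pochhammer \<alpha> n / (pochhammer (2 * \<alpha>) n * pochhammer c n * fact n))"
    using pc[of n] pochhammer_pos[of "2 * \<alpha>" n] assms by (simp add: field_simps)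
  thus ?thesis by (simp add: S_def c_def)
qed

text \<open>The convolution identity says that \<open>1F2(\<alpha>; 2 * \<alpha>, \<alpha> + 1/2; x)\<close> is the square of
  \<open>0F1(; \<alpha> + 1/2; x / 4)\<close>, whose series is \<open>g x\<close> in the proof.\<close>

lemma nonneg_entire_Bessel_square:
  fixes \<alpha> :: real
  assumes "0 < \<alpha>"
  shows "nonneg_entire
    (\<lambda>n. pochhammer \<alpha> n / (pochhammer (2 * \<alpha>) n * pochhammer (\<alpha> + 1/2) n * fact n))"
    (is "nonneg_entire ?f")
proof -
  define g where "g x k = 1 / (pochhammer (\<alpha> + 1/2) k * fact k) * (x / 4) ^ k" for x :: real and k
  \<comment> \<open>Every factor of the symbol exceeds \<open>1/2\<close>, so \<open>g x\<close> is dominated by an exponential series.\<close>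
  have poch: "(1/2) ^ k \<le> pochhammer (\<alpha> + 1/2) k" for k
  proof (induction k)
    case (Suc k)
    have "(1/2) ^ k * (1/2) \<le> pochhammer (\<alpha> + 1/2) k * (\<alpha> + 1/2 + k)"
      using assms by (intro mult_mono Suc pochhammer_nonneg) auto
    thus ?case by (simp add: pochhammer_Suc mult.commute)
  qed simp
  have pos: "0 < pochhammer (\<alpha> + 1/2) k" for k
    using assms by (intro pochhammer_pos) simp
  have summable_g: "summable (\<lambda>k. norm (g x k))" for x
  proof (rule summable_comparison_test')
    show "summable (\<lambda>k. inverse (fact k) * (2 * \<bar>x / 4\<bar>) ^ k)"
      by (rule summable_exp)
    show "norm (norm (g x k)) \<le> inverse (fact k) * (2 * \<bar>x / 4\<bar>) ^ k" for k
    proof -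
      have "1 / pochhammer (\<alpha> + 1/2) k \<le> 1 / (1/2) ^ k"
        by (rule frac_le) (simp_all only: poch zero_le_one order_refl, simp)
      hence "1 / pochhammer (\<alpha> + 1/2) k \<le> 2 ^ k"
        by (simp add: power_one_over)
      hence "1 / pochhammer (\<alpha> + 1/2) k * (\<bar>x / 4\<bar> ^ k / fact k) \<le> 2 ^ k * (\<bar>x / 4\<bar> ^ k / fact k)"
        by (rule mult_right_mono) simp
      moreover have "norm (norm (g x k)) = 1 / pochhammer (\<alpha> + 1/2) k * (\<bar>x / 4\<bar> ^ k / fact k)"
        using pos[of k] by (simp add: g_def abs_mult power_abs)
      moreover have "2 ^ k * (\<bar>x / 4\<bar> ^ k / fact k) = inverse (fact k) * (2 * \<bar>x / 4\<bar>) ^ k"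
        unfolding power_mult_distrib divide_inverse[of _ "fact k"] by (simp only: mult_ac)
      ultimately show ?thesis by simp
    qed
  qed
  have conv: "(\<Sum>i\<le>n. g x i * g x (n - i)) = ?f n * x ^ n" for x n
  proof -
    have "(\<Sum>i\<le>n. g x i * g x (n - i)) =
        (\<Sum>i\<le>n. 1 / (pochhammer (\<alpha> + 1/2) i * fact i) *
              (1 / (pochhammer (\<alpha> + 1/2) (n - i) * fact (n - i)))) * (x / 4) ^ n"
      unfolding sum_distrib_right
    proof (rule sum.cong[OF refl])
      fix i assume "i \<in> {..n}"
      hence "(x / 4) ^ n = (x / 4) ^ i * (x / 4) ^ (n - i)"
        by (simp flip: power_add)
      thus "g x i * g x (n - i) = 1 / (pochhammer (\<alpha> + 1/2) i * fact i) *
              (1 / (pochhammer (\<alpha> + 1/2) (n - i) * fact (n - i))) * (x / 4) ^ n"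
        by (simp add: g_def)
    qed
    also have "\<dots> = ?f n * x ^ n"
      unfolding sum_inverse_pochhammer_convolution[OF assms] by (simp add: power_divide)
    finally show ?thesis .
  qed
  have "summable (\<lambda>n. \<bar>?f n * x ^ n\<bar>)" for x
  proof -
    have "summable (\<lambda>n. ?f n * \<bar>x\<bar> ^ n)"
      using summable_Cauchy_product[OF summable_g[of "\<bar>x\<bar>"] summable_g[of "\<bar>x\<bar>"]]
      by (simp add: conv)
    moreover have "0 \<le> ?f n" for n
      using assms by (intro divide_nonneg_nonneg mult_nonneg_nonneg pochhammer_nonneg) auto
    hence "\<bar>?f n * x ^ n\<bar> = ?f n * \<bar>x\<bar> ^ n" for n
      by (simp only: abs_mult power_abs abs_of_nonneg)
    ultimately show ?thesis by (simp only:)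
  qed
  moreover have "0 \<le> (\<Sum>n. ?f n * x ^ n)" for x
    using Cauchy_product[OF summable_g[of x] summable_g[of x]] zero_le_square[of "\<Sum>k. g x k"]
    by (simp only: conv)
  ultimately show ?thesis by (simp add: nonneg_entire_def)
qed

lemma foldl_mult_pochhammer:
  fixes as :: "real list"
  shows "foldl (\<lambda>r a. r * pochhammer a n) r as = r * (\<Prod>j<length as. pochhammer (as ! j) n)"
  by (induction as arbitrary: r) (simp_all add: prod.lessThan_Suc_shift del: prod.lessThan_Suc)

theorem theorem4:
  fixes p :: nat and \<alpha> \<beta>1 \<beta>2 :: real and a b :: "real list"
  assumes "p \<ge> 2"
    and "\<alpha> > 0"
    and "(\<beta>1, \<beta>2) \<in> P_region \<alpha>"
    and "length a = p - 1"
    and "length b = p - 1"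
    and "\<forall>x\<in>set a. x > 0"
  shows "((\<forall>t\<in>{0..1}. v_fun a b t \<ge> 0) \<longrightarrow>
            (\<forall>x. hypergeo (\<alpha> # a) (\<beta>1 # \<beta>2 # b) x \<ge> 0)) \<and>
         (b \<prec>\<^sup>W a \<longrightarrow> (\<forall>t\<in>{0..1}. v_fun a b t \<ge> 0))"
proof (intro conjI impI allI ballI)
  show "0 \<le> v_fun a b t" if "b \<prec>\<^sup>W a" "t \<in> {0..1}" for t
    using that by (rule weak_supermajorized_imp_v_fun_nonneg)
next
  fix x assume v: "\<forall>t\<in>{0..1}. 0 \<le> v_fun a b t"
  have len: "length b = length a"
    using assms by simp
  define as where "as = 2 * \<alpha> # (\<alpha> + 1/2) # a"
  define bs where "bs = \<beta>1 # \<beta>2 # b"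
  define f where "f n = pochhammer \<alpha> n / (pochhammer (2 * \<alpha>) n * pochhammer (\<alpha> + 1/2) n * fact n)" for n
  define m where "m n = (\<Prod>j<length as. pochhammer (as ! j) n / pochhammer (bs ! j) n)" for n
  have "\<forall>t\<in>{0..1}. 0 \<le> v_fun as bs t"
    using v weak_supermajorized_imp_v_fun_nonneg[OF P_region_imp_weak_supermajorized[OF assms(2,3)]]
    by (fastforce simp: as_def bs_def v_fun_Cons v_fun_def[of "[]"])
  hence m: "positivity_multiplier m"
    unfolding m_def using assms
    by (intro positivity_multiplier_pochhammer_lists) (auto simp: as_def bs_def)
  have "fps_nth (fps_hypergeo (\<alpha> # a) (\<beta>1 # \<beta>2 # b) 1) n = f n * m n" for n
  proof -
    have "pochhammer (2 * \<alpha>) n > 0" "pochhammer (\<alpha> + 1/2) n > 0"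
      using assms by (auto intro!: pochhammer_pos)
    thus ?thesis
      using len
      by (simp add: f_def m_def as_def bs_def foldl_mult_pochhammer prod.lessThan_Suc_shift
          prod_dividef del: prod.lessThan_Suc)
  qed
  hence "hypergeo (\<alpha> # a) (\<beta>1 # \<beta>2 # b) x = (\<Sum>n. f n * m n * x ^ n)"
    by (simp add: hypergeo_def eval_fps_def)
  also have "\<dots> \<ge> 0"
    using m nonneg_entire_Bessel_square[OF assms(2)]
    unfolding f_def by (rule positivity_multiplier_suminf_nonneg)
  finally show "0 \<le> hypergeo (\<alpha> # a) (\<beta>1 # \<beta>2 # b) x" .
qed

end
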